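(* Let $\alpha=(\alpha_1,\alpha_2)\in\mathbb Z^2$ satisfy $d\alpha_1<\alpha_2<0$ (that is, $\alpha$ lies in the Euler-Jacobi cone). Then the $\mathcal A$-hypergeometric system with exponent $\alpha$ has no nonzero rational solution $\varphi\in\mathbb C(x_j: j\in\Lambda)$.
   Context: Setting: $m\ge 1$ and $0<k_1<\dots<k_m<d$ are integers with $\gcd(k_1,\dots,k_m,d)=1$; $\Lambda=\{0,k_1,\dots,k_m,d\}$, and all $(m+2)$-tuples are indexed by $\Lambda$. $\mathcal A$ is the $2\times(m+2)$ integer matrix whose columns are $(1,j)^T$, $j\in\Lambda$. Variables $x=(x_j)_{j\in\Lambda}$. The $\mathcal A$-hypergeometric system with exponent $\alpha=(\alpha_1,\alpha_2)$ consists of the equations $\prod_{v_j>0}(\partial/\partial x_j)^{v_j}\varphi=\prod_{v_j<0}(\partial/\partial x_j)^{-v_j}\varphi$ for all $v\in\mathbb Z^{\Lambda}$ with $\mathcal A v=0$, together with $\sum_{j\in\Lambda}x_j\,\partial\varphi/\partial x_j=\alpha_1\varphi$ and $\sum_{j\in\Lambda}j\,x_j\,\partial\varphi/\partial x_j=\alpha_2\varphi$. The Euler-Jacobi cone is $\{(\alpha_1,\alpha_2)\in\mathbb Z^2: d\alpha_1<\alpha_2<0\}$. *)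

theory Defs
  imports Complex_Main "HOL-Library.Poly_Mapping" "HOL-Computational_Algebra.Fraction_Field"
begin

text \<open>
  Polynomials with complex coefficients in countably many variables \<open>x\<^sub>0, x\<^sub>1, \<dots>\<close>: a monomial is
  its exponent function (finitely supported), a polynomial its coefficient function. The class
  instances of \<^theory>\<open>HOL-Library.Poly_Mapping\<close> make this type an integral domain, so
  \<open>ratfun\<close> is its field of fractions. Only the subfield generated by the variables indexed by
  a finite set is used below.
\<close>

type_synonym cpoly = "(nat \<Rightarrow>\<^sub>0 nat) \<Rightarrow>\<^sub>0 complex"
type_synonym ratfun = "cpoly fract"

definition vars :: "cpoly \<Rightarrow> nat set" where
  "vars p = (\<Union>m\<in>Poly_Mapping.keys p. Poly_Mapping.keys m)"

definition rational_functions :: "nat set \<Rightarrow> ratfun set" where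
  "rational_functions L = {Fract p q |p q. vars p \<subseteq> L \<and> vars q \<subseteq> L \<and> q \<noteq> 0}"

definition var :: "nat \<Rightarrow> ratfun" where
  "var j = Fract (Poly_Mapping.single (Poly_Mapping.single j 1) 1) 1"


text \<open>
  Formal partial derivative of polynomials. The subtraction of exponents is truncated, but the
  coefficient vanishes whenever the truncation takes effect.
\<close>

definition poly_diff :: "nat \<Rightarrow> cpoly \<Rightarrow> cpoly" where
  "poly_diff j p = (\<Sum>m\<in>Poly_Mapping.keys p. Poly_Mapping.single (m - Poly_Mapping.single j 1)
                                   (of_nat (Poly_Mapping.lookup m j) * Poly_Mapping.lookup p m))"

lemma poly_diff_superset:
  assumes "finite K" "Poly_Mapping.keys p \<subseteq> K"
  shows "poly_diff j p = (\<Sum>m\<in>K. Poly_Mapping.single (m - Poly_Mapping.single j 1)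
                                   (of_nat (Poly_Mapping.lookup m j) * Poly_Mapping.lookup p m))"
  unfolding poly_diff_def using assms
  by (intro sum.mono_neutral_left) (auto simp: in_keys_iff)

lemma poly_diff_single:
  "poly_diff j (Poly_Mapping.single m c) =
     Poly_Mapping.single (m - Poly_Mapping.single j 1) (of_nat (Poly_Mapping.lookup m j) * c)"
  by (subst poly_diff_superset[of "{m}"]) auto

lemma poly_diff_0 [simp]: "poly_diff j 0 = 0"
  by (simp add: poly_diff_def)

lemma poly_diff_add: "poly_diff j (p + q) = poly_diff j p + poly_diff j q"
proof -
  let ?K = "Poly_Mapping.keys p \<union> Poly_Mapping.keys q"
  have K: "finite ?K" "Poly_Mapping.keys p \<subseteq> ?K" "Poly_Mapping.keys q \<subseteq> ?K" "Poly_Mapping.keys (p + q) \<subseteq> ?K"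
    using Poly_Mapping.keys_add[of p q] by auto
  show ?thesis
    by (simp add: poly_diff_superset[OF K(1,2)] poly_diff_superset[OF K(1,3)]
        poly_diff_superset[OF K(1,4)] lookup_add algebra_simps single_add sum.distrib)
qed

lemma poly_diff_uminus: "poly_diff j (- p) = - poly_diff j p"
  using poly_diff_add[of j p "- p"] by (simp add: eq_neg_iff_add_eq_0 add.commute)

lemma poly_diff_minus: "poly_diff j (p - q) = poly_diff j p - poly_diff j q"
  using poly_diff_add[of j p "- q"] by (simp add: poly_diff_uminus)

lemma cpoly_induct [case_names zero monom add]:
  fixes p :: cpoly
  assumes "P 0" "\<And>m c. P (Poly_Mapping.single m c)" "\<And>p q. P p \<Longrightarrow> P q \<Longrightarrow> P (p + q)"
  shows "P p"
proof (induction p rule: update_induct)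
  case const
  have "(0 :: cpoly) = Abs_poly_mapping (\<lambda>k. 0)" by simp
  then show ?case using assms(1) by simp
next
  case (update f a b)
  have "Poly_Mapping.update a b f = f + Poly_Mapping.single a b"
    using update by (intro poly_mapping_eqI)
      (auto simp: lookup_update lookup_add lookup_single in_keys_iff when_def)
  then show ?case using update assms by metis
qed

lemma poly_diff_mult_monom:
  "poly_diff j (Poly_Mapping.single m a * Poly_Mapping.single n b) =
   poly_diff j (Poly_Mapping.single m a) * Poly_Mapping.single n b +
   Poly_Mapping.single m a * poly_diff j (Poly_Mapping.single n b)"
proof -
  let ?e = "Poly_Mapping.single j (1::nat)"
  have 1: "m - ?e + n = m + n - ?e" if "Poly_Mapping.lookup m j \<noteq> 0"
    using that by (intro poly_mapping_eqI) (auto simp: lookup_add lookup_minus lookup_single when_def)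
  have 2: "m + (n - ?e) = m + n - ?e" if "Poly_Mapping.lookup n j \<noteq> 0"
    using that by (intro poly_mapping_eqI) (auto simp: lookup_add lookup_minus lookup_single when_def)
  show ?thesis
    using 1 2 by (cases "Poly_Mapping.lookup m j = 0"; cases "Poly_Mapping.lookup n j = 0")
      (auto simp: poly_diff_single mult_single lookup_add algebra_simps
        simp flip: single_add)
qed

lemma poly_diff_mult: "poly_diff j (p * q) = poly_diff j p * q + p * poly_diff j q"
proof (induction p rule: cpoly_induct)
  case (monom m c)
  show ?case
    by (induction q rule: cpoly_induct)
      (auto simp: poly_diff_mult_monom poly_diff_add algebra_simps)
qed (auto simp: poly_diff_add algebra_simps)

lemma poly_diff_commute: "poly_diff i (poly_diff j p) = poly_diff j (poly_diff i p)"
proof (induction p rule: cpoly_induct)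
  case (monom m c)
  have "m - Poly_Mapping.single j 1 - Poly_Mapping.single i 1 =
        m - Poly_Mapping.single i 1 - Poly_Mapping.single j (1::nat)"
    by (intro poly_mapping_eqI) (auto simp: lookup_minus)
  then show ?case
    by (cases "i = j") (auto simp: poly_diff_single lookup_minus lookup_single algebra_simps)
qed (auto simp: poly_diff_add)


text \<open>Partial derivative of rational functions, by the quotient rule.\<close>

lemma quotient_rule_cong:
  fixes p q p' q' dp dq dp' dq' :: "'a :: comm_ring_1"
  assumes "p * q' = p' * q" and "dp * q' + p * dq' = dp' * q + p' * dq"
  shows "(dp * q - p * dq) * (q' * q') = (dp' * q' - p' * dq') * (q * q)"
proof -
  have "(dp * q - p * dq) * (q' * q') - (dp' * q' - p' * dq') * (q * q) =
        q * q' * ((dp * q' + p * dq') - (dp' * q + p' * dq)) - (q * dq' + q' * dq) * (p * q' - p' * q)"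
    by (simp add: algebra_simps)
  then show ?thesis
    using assms by simp
qed

lift_definition pdiff :: "nat \<Rightarrow> ratfun \<Rightarrow> ratfun" is
  "\<lambda>j (p, q). (poly_diff j p * q - p * poly_diff j q, q * q)"
proof (clarsimp)
  fix j :: nat and p q p' q' :: cpoly
  assume *: "p * q' = p' * q"
  have "poly_diff j p * q' + p * poly_diff j q' = poly_diff j p' * q + p' * poly_diff j q"
    using arg_cong[OF *, of "poly_diff j"] by (simp only: poly_diff_mult)
  with * show "(poly_diff j p * q - p * poly_diff j q) * (q' * q') =
        (poly_diff j p' * q' - p' * poly_diff j q') * (q * q)"
    by (rule quotient_rule_cong)
qed

lemma pdiff_Fract:
  "q \<noteq> 0 \<Longrightarrow> pdiff j (Fract p q) = Fract (poly_diff j p * q - p * poly_diff j q) (q * q)"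
  by (simp add: Fract.abs_eq pdiff.abs_eq)

lemma second_quotient_rule_symmetric:
  fixes p q pi pj qi qj pij qij :: "'a :: comm_ring_1"
  shows "((pij * q + pj * qi) - (pi * qj + p * qij)) * (q * q) - (pj * q - p * qj) * (qi * q + q * qi) =
         ((pij * q + pi * qj) - (pj * qi + p * qij)) * (q * q) - (pi * q - p * qi) * (qj * q + q * qj)"
  by (simp add: algebra_simps)

lemma pdiff_commute: "pdiff i (pdiff j f) = pdiff j (pdiff i f)"
proof (cases f)
  case (Fract p q)
  let ?N = "\<lambda>i j. poly_diff i (poly_diff j p * q - p * poly_diff j q) * (q * q) -
                  (poly_diff j p * q - p * poly_diff j q) * poly_diff i (q * q)"
  have "pdiff i (pdiff j f) = Fract (?N i j) (q * q * (q * q))" for i j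
    using Fract by (simp add: pdiff_Fract)
  moreover have "?N i j = ?N j i"
    unfolding poly_diff_minus poly_diff_mult poly_diff_commute[of j i]
    by (rule second_quotient_rule_symmetric)
  ultimately show ?thesis by simp
qed


text \<open>
  \<open>pdiff_monom L u\<close> is the operator \<open>\<Prod>j\<in>L. (\<partial>/\<partial>x\<^sub>j) ^ u j\<close>; the lemma \<open>comp_fun_commute_pdiff\<close>
  shows that the order of composition is immaterial, so that the fold is meaningful.
\<close>

definition pdiff_monom :: "nat set \<Rightarrow> (nat \<Rightarrow> nat) \<Rightarrow> ratfun \<Rightarrow> ratfun" where
  "pdiff_monom L u f = Finite_Set.fold (\<lambda>j. pdiff j ^^ u j) f L"

lemma comp_fun_commute_pdiff: "comp_fun_commute (\<lambda>j. pdiff j ^^ u j)"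
proof
  have 1: "(pdiff i ^^ n) (pdiff j f) = pdiff j ((pdiff i ^^ n) f)" for i j n f
    by (induction n) (auto simp: pdiff_commute[of i j])
  have "(pdiff i ^^ n) ((pdiff j ^^ k) f) = (pdiff j ^^ k) ((pdiff i ^^ n) f)" for i j n k f
    by (induction k) (auto simp: 1)
  then show "(pdiff i ^^ u i) \<circ> (pdiff j ^^ u j) = (pdiff j ^^ u j) \<circ> (pdiff i ^^ u i)" for i j
    by auto
qed

lemma pdiff_monom_empty: "pdiff_monom {} u f = f"
  by (simp add: pdiff_monom_def)

lemma pdiff_monom_insert:
  "finite L \<Longrightarrow> j \<notin> L \<Longrightarrow> pdiff_monom (insert j L) u f = (pdiff j ^^ u j) (pdiff_monom L u f)"
  using comp_fun_commute_on.fold_insert[OF comp_fun_commute_pdiff[unfolded comp_fun_commute_def'], of j L] by (simp add: pdiff_monom_def)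


definition Lambda :: "nat \<Rightarrow> (nat \<Rightarrow> nat) \<Rightarrow> nat \<Rightarrow> nat set" where
  "Lambda m k d = {0} \<union> k ` {1..m} \<union> {d}"

text \<open>
  The matrix with columns \<open>(1, j)\<^sup>T\<close>, \<open>j \<in> \<Lambda>\<close>; the row index ranges over \<open>{0, 1}\<close>.
\<close>

definition A_mat :: "nat \<Rightarrow> nat \<Rightarrow> int" where
  "A_mat i j = (if i = 0 then 1 else int j)"

definition A_kernel :: "nat set \<Rightarrow> (nat \<Rightarrow> int) set" where
  "A_kernel L = {v. \<forall>i\<in>{0, 1}. (\<Sum>j\<in>L. A_mat i j * v j) = 0}"

text \<open>
  Since \<open>nat\<close> truncates negative integers to 0, the exponents \<open>nat (v j)\<close> and \<open>nat (- v j)\<close>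
  restrict the two products to the indices with \<open>v j > 0\<close> and \<open>v j < 0\<close>, respectively.
\<close>

definition A_hypergeometric :: "nat set \<Rightarrow> int \<times> int \<Rightarrow> ratfun \<Rightarrow> bool" where
  "A_hypergeometric L \<alpha> f \<longleftrightarrow>
     (\<forall>v\<in>A_kernel L. pdiff_monom L (\<lambda>j. nat (v j)) f = pdiff_monom L (\<lambda>j. nat (- v j)) f) \<and>
     (\<Sum>j\<in>L. var j * pdiff j f) = of_int (fst \<alpha>) * f \<and>
     (\<Sum>j\<in>L. of_nat j * var j * pdiff j f) = of_int (snd \<alpha>) * f"

end

theory Submission
  imports Defs "HOL-Library.Function_Algebras" "HOL-Computational_Algebra.Primes"
begin

text \<open>
  The idea is to expand a rational solution \<open>p / q\<close> as a Laurent series in the region where \<open>x\<^sub>0\<close> and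
  \<open>x\<^sub>d\<close> dominate, to observe that the system determines this series up to a scalar, and to see that
  the denominators of its coefficients contain too many primes for a rational function.

  The expansion is taken with respect to the weight that gives the variable \<open>x\<^sub>j\<close> the weight
  \<open>B ^ j\<close>. For a large base \<open>B\<close> it singles out one monomial of \<open>q\<close> as the heaviest, so there is a
  unique series \<open>c\<close> with \<open>q c = p\<close> and weights bounded above (\<open>expansion_exists\<close>,
  \<open>leading_cancellable\<close>). The box equations turn into recurrences between the coefficients at \<open>u\<close>
  and \<open>u + v\<close> for \<open>v\<close> in the kernel of the matrix, whose factors vanish only if a sign changes
  between nonnegative and negative (\<open>expansion_is_hypergeometric_series\<close>).

  Because \<open>j \<mapsto> B ^ j\<close> is convex, a negative exponent of an interior variable \<open>x\<^sub>j\<close> would propagate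
  along the circuit \<open>(d - j) e\<^sub>0 - d e\<^sub>j + j e\<^sub>d\<close> to exponents of arbitrarily large weight; so it does not
  occur (\<open>support_interior_nonneg\<close>). The Euler-Jacobi condition then makes the exponents of \<open>x\<^sub>0\<close> and
  \<open>x\<^sub>d\<close> negative throughout (\<open>support_endpoints_negative\<close>). Hence all exponents of the series have the same
  signs, and the recurrences express every coefficient as a rational multiple of any nonzero one
  (\<open>ratio_rational\<close>). The coefficients along the direction opposite to the circuit behave like
  \<open>(a + n (d - j))! (b + n j)! / (e + n d)!\<close>, up to sign and a constant factor; their denominators contain
  arbitrarily large primes (\<open>large_prime_denominator\<close>). But once \<open>p\<close> and \<open>q\<close> are made
  rational, the recursion that computes \<open>p / q\<close> only divides by powers of one fixed integer
  (\<open>denominators_of_rational_expansion\<close>).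
\<close>

section \<open>Formal Laurent series as a module over the Weyl algebra\<close>

type_synonym series = "(nat \<Rightarrow> int) \<Rightarrow> complex"

definition exponent :: "(nat \<Rightarrow>\<^sub>0 nat) \<Rightarrow> nat \<Rightarrow> int" where
  "exponent m = (\<lambda>j. int (Poly_Mapping.lookup m j))"

definition unit_exponent :: "nat \<Rightarrow> nat \<Rightarrow> int" where
  "unit_exponent j = (\<lambda>i. of_bool (i = j))"

definition exponent_on :: "nat set \<Rightarrow> (nat \<Rightarrow> nat) \<Rightarrow> nat \<Rightarrow> int" where
  "exponent_on L w = (\<lambda>j. if j \<in> L then int (w j) else 0)"

text \<open>
  Series are arbitrary coefficient functions, so two of them cannot be multiplied; but each
  coefficient of a polynomial times a series is a finite sum. Together with termwise derivation
  this module structure is all that is needed.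
\<close>

definition act :: "cpoly \<Rightarrow> series \<Rightarrow> series" where
  "act p c = (\<lambda>u. \<Sum>m\<in>Poly_Mapping.keys p. Poly_Mapping.lookup p m * c (u - exponent m))"

definition one_series :: series where
  "one_series = (\<lambda>u. of_bool (u = 0))"

definition sdiff :: "nat \<Rightarrow> series \<Rightarrow> series" where
  "sdiff j c = (\<lambda>u. of_int (u j + 1) * c (u + unit_exponent j))"

lemma exponent_0 [simp]: "exponent 0 = 0"
  by (auto simp: exponent_def)

lemma exponent_add: "exponent (m + n) = exponent m + exponent n"
  by (auto simp: exponent_def lookup_add)

lemma exponent_single_1: "exponent (Poly_Mapping.single j (Suc 0)) = unit_exponent j"
  by (auto simp: exponent_def unit_exponent_def lookup_single when_def)

lemma exponent_minus_single:
  assumes "Poly_Mapping.lookup m j \<noteq> 0"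
  shows "exponent (m - Poly_Mapping.single j 1) = exponent m - unit_exponent j"
  using assms
  by (auto simp: fun_eq_iff exponent_def unit_exponent_def lookup_minus lookup_single when_def)

lemma inj_exponent: "exponent m = exponent n \<Longrightarrow> m = n"
  by (auto simp: exponent_def fun_eq_iff intro!: poly_mapping_eqI)

lemma act_superset:
  assumes "finite K" "Poly_Mapping.keys p \<subseteq> K"
  shows "act p c u = (\<Sum>m\<in>K. Poly_Mapping.lookup p m * c (u - exponent m))"
  unfolding act_def using assms
  by (intro sum.mono_neutral_left) (auto simp: in_keys_iff)

lemma act_single [simp]: "act (Poly_Mapping.single m a) c = (\<lambda>u. a * c (u - exponent m))"
  by (rule ext, subst act_superset[of "{m}"]) auto

lemma act_1 [simp]: "act 1 c = c"
  using act_single[of 0 1 c] by simp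

lemma act_0_left [simp]: "act 0 c = 0"
  by (simp add: act_def fun_eq_iff)

lemma act_0_right [simp]: "act p 0 = 0"
  by (simp add: act_def fun_eq_iff)

lemma act_add_left: "act (p + q) c = act p c + act q c"
proof
  fix u
  let ?K = "Poly_Mapping.keys p \<union> Poly_Mapping.keys q"
  have K: "finite ?K" "Poly_Mapping.keys p \<subseteq> ?K" "Poly_Mapping.keys q \<subseteq> ?K" "Poly_Mapping.keys (p + q) \<subseteq> ?K"
    using Poly_Mapping.keys_add[of p q] by auto
  show "act (p + q) c u = (act p c + act q c) u"
    by (simp add: act_superset[OF K(1,2)] act_superset[OF K(1,3)] act_superset[OF K(1,4)]
        lookup_add algebra_simps sum.distrib)
qed

lemma act_add_right: "act p (c + c') = act p c + act p c'"
  by (simp add: act_def fun_eq_iff algebra_simps sum.distrib)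

lemma act_diff_right: "act p (c - c') = act p c - act p c'"
  by (simp add: act_def fun_eq_iff algebra_simps sum_subtractf)

lemma act_diff_left: "act (p - q) c = act p c - act q c"
  using act_add_left[of "p - q" q c] by simp

lemma act_scale_right: "act p (\<lambda>u. a * c u) = (\<lambda>u. a * act p c u)"
  by (simp add: act_def sum_distrib_left algebra_simps)

lemma act_mult: "act (p * q) c = act p (act q c)"
proof (induction p rule: cpoly_induct)
  case (monom m a)
  show ?case
  proof (induction q rule: cpoly_induct)
    case (monom n b)
    show ?case
      by (simp add: mult_single exponent_add diff_diff_eq mult.assoc)
  qed (simp_all only: distrib_left act_add_left act_add_right mult_zero_right act_0_left act_0_right)
qed (simp_all only: distrib_right act_add_left mult_zero_left act_0_left)

lemma act_commute: "act p (act q c) = act q (act p c)"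
  by (metis act_mult mult.commute)

lemma sdiff_add: "sdiff j (c + c') = sdiff j c + sdiff j c'"
  by (simp add: sdiff_def fun_eq_iff algebra_simps)

text \<open>
  The coefficient at \<open>- unit_exponent j\<close>, the only place where the shifted delta function is
  nonzero, is multiplied by \<open>u j + 1 = 0\<close>.
\<close>

lemma sdiff_one_series [simp]: "sdiff j one_series = 0"
proof
  fix u
  have "u j = -1" if "u + unit_exponent j = 0"
    using fun_cong[OF that, of j] by (simp add: unit_exponent_def)
  then show "sdiff j one_series u = 0 u"
    by (auto simp: sdiff_def one_series_def)
qed

text \<open>
  The Leibniz rule, which makes \<^const>\<open>sdiff\<close> compatible with the quotient rule. On a monomial it
  is the identity \<open>u j + 1 = m j + (u j - m j + 1)\<close>.
\<close>

lemma sdiff_act: "sdiff j (act p c) = act (poly_diff j p) c + act p (sdiff j c)"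
proof (induction p rule: cpoly_induct)
  case zero
  show ?case by (simp add: sdiff_def fun_eq_iff)
next
  case (monom m a)
  show ?case
  proof
    fix u
    let ?l = "Poly_Mapping.lookup m j"
    have 1: "u - exponent m + unit_exponent j = u + unit_exponent j - exponent m"
      by simp
    have 2: "u - exponent (m - Poly_Mapping.single j (Suc 0)) = u + unit_exponent j - exponent m" if "?l > 0"
      using exponent_minus_single[of m j] that by (simp add: algebra_simps)
    have 3: "exponent m j = int ?l"
      by (simp add: exponent_def)
    have "sdiff j (act (Poly_Mapping.single m a) c) u =
        of_int (u j + 1) * (a * c (u + unit_exponent j - exponent m))"
      by (simp add: sdiff_def)
    also have "\<dots> = of_nat ?l * a * c (u - exponent (m - Poly_Mapping.single j (Suc 0))) +
        a * (of_int (u j - int ?l + 1) * c (u + unit_exponent j - exponent m))"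
      using 2 by (cases "?l = 0") (auto simp: algebra_simps)
    also have "\<dots> = (act (poly_diff j (Poly_Mapping.single m a)) c + act (Poly_Mapping.single m a) (sdiff j c)) u"
      unfolding poly_diff_single by (simp add: sdiff_def 1 3)
    finally show "sdiff j (act (Poly_Mapping.single m a) c) u =
      (act (poly_diff j (Poly_Mapping.single m a)) c + act (Poly_Mapping.single m a) (sdiff j c)) u" .
  qed
next
  case (add p q)
  then show ?case
    by (simp only: act_add_left poly_diff_add sdiff_add) (simp only: ac_simps)
qed

lemma act_one_series_exponent: "act p one_series (exponent m) = Poly_Mapping.lookup p m"
proof -
  have "act p one_series (exponent m) =
      (\<Sum>n\<in>Poly_Mapping.keys p. if n = m then Poly_Mapping.lookup p m else 0)"
    unfolding act_def one_series_def by (intro sum.cong) (auto dest: inj_exponent)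
  then show ?thesis by (simp add: in_keys_iff)
qed

lemma act_one_series_eq_0: "act p one_series = 0 \<Longrightarrow> p = 0"
  using act_one_series_exponent[of p] by (auto intro!: poly_mapping_eqI)

lemma act_one_series_neq_0E:
  assumes "act p one_series u \<noteq> 0"
  obtains m where "m \<in> Poly_Mapping.keys p" "u = exponent m"
proof -
  obtain m where "m \<in> Poly_Mapping.keys p" "one_series (u - exponent m) \<noteq> 0"
    using sum.not_neutral_contains_not_neutral[OF assms[unfolded act_def]] by auto
  then show ?thesis
    using that by (auto simp: one_series_def)
qed


section \<open>Expansions of rational functions\<close>

lemma Fract_of_int_eq: "Fract (of_int i) 1 = (of_int i :: ratfun)"
proof (cases "i \<ge> 0")
  case True
  then show ?thesis using Fract_of_nat_eq[of "nat i", where ?'a = cpoly] by simp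
next
  case False
  then have "Fract (- of_int i) 1 = (- of_int i :: ratfun)"
    using Fract_of_nat_eq[of "nat (- i)", where ?'a = cpoly] by simp
  then show ?thesis
    by (metis minus_fract minus_minus)
qed

text \<open>
  Any additive function on exponents serves to order the monomials; what makes it
  useful for a given denominator is a single heaviest monomial (\<open>leading\<close> below).
\<close>

locale weight =
  fixes W :: "(nat \<Rightarrow> int) \<Rightarrow> int"
  assumes W_add: "W (u + v) = W u + W v"
begin

lemma W_diff: "W (u - v) = W u - W v"
  using W_add[of "u - v" v] by simp

lemma W_multiple: "W (\<lambda>i. int n * v i) = int n * W v"
proof (induction n)
  case 0
  have "(\<lambda>i. int 0 * v i) = 0" by (simp add: fun_eq_iff)
  then show ?case using W_add[of 0 0] by simp
next
  case (Suc n)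
  have "(\<lambda>i. int (Suc n) * v i) = (\<lambda>i. int n * v i) + v" by (simp add: fun_eq_iff algebra_simps)
  then show ?case using Suc by (simp add: W_add algebra_simps)
qed

definition bounded :: "series \<Rightarrow> bool" where
  "bounded c \<longleftrightarrow> (\<exists>N. \<forall>u. c u \<noteq> 0 \<longrightarrow> W u \<le> N)"

text \<open>
  In the module of all series polynomials may have torsion: the two-sided geometric series is
  killed by \<open>1 - x\<close>. Among series bounded in weight the torsion disappears for a suitable
  denominator.
\<close>

definition cancellable :: "cpoly \<Rightarrow> bool" where
  "cancellable q \<longleftrightarrow> q \<noteq> 0 \<and> (\<forall>c. bounded c \<longrightarrow> act q c = 0 \<longrightarrow> c = 0)"

text \<open>
  The series \<open>c\<close> is a solution of \<open>q c = p\<close> for some fraction \<open>p / q\<close> representing \<open>f\<close>. Admitting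
  every cancellable denominator makes the relation stable under sums and derivatives.
\<close>

definition expands :: "ratfun \<Rightarrow> series \<Rightarrow> bool" where
  "expands f c \<longleftrightarrow> bounded c \<and>
     (\<exists>p q. cancellable q \<and> f = Fract p q \<and> act q c = act p one_series)"

lemma bounded_0 [simp]: "bounded 0"
  by (simp add: bounded_def)

lemma bounded_add:
  assumes "bounded c" "bounded c'" shows "bounded (c + c')"
proof -
  obtain N N' where N: "\<And>u. c u \<noteq> 0 \<Longrightarrow> W u \<le> N" "\<And>u. c' u \<noteq> 0 \<Longrightarrow> W u \<le> N'"
    using assms unfolding bounded_def by blast
  have "W u \<le> max N N'" if "(c + c') u \<noteq> 0" for u
  proof (cases "c u = 0")
    case True
    then show ?thesis using that N(2)[of u] by simp
  next
    case False
    then show ?thesis using N(1)[of u] by simp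
  qed
  then show ?thesis unfolding bounded_def by blast
qed

lemma bounded_scaled_shift:
  assumes "bounded c" shows "bounded (\<lambda>u. a u * c (u - v))"
proof -
  obtain N where N: "\<And>u. c u \<noteq> 0 \<Longrightarrow> W u \<le> N"
    using assms unfolding bounded_def by blast
  have "W u \<le> N + W v" if "a u * c (u - v) \<noteq> 0" for u
    using N[of "u - v"] that by (simp add: W_diff)
  then show ?thesis unfolding bounded_def by blast
qed

lemma bounded_diff:
  assumes "bounded c" "bounded c'" shows "bounded (c - c')"
proof -
  have "c - c' = c + (\<lambda>u. (-1) * c' (u - 0))"
    by (simp add: fun_eq_iff)
  then show ?thesis
    by (simp only:) (intro bounded_add bounded_scaled_shift assms)
qed

lemma bounded_sdiff: "bounded c \<Longrightarrow> bounded (sdiff j c)"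
  using bounded_scaled_shift[of c "\<lambda>u. of_int (u j + 1)" "- unit_exponent j"]
  by (simp add: sdiff_def)

lemma bounded_act: "bounded c \<Longrightarrow> bounded (act p c)"
  by (induction p rule: cpoly_induct)
    (auto simp: act_add_left intro: bounded_add bounded_scaled_shift)

lemma cancellable_1: "cancellable 1"
  by (simp add: cancellable_def)

lemma cancellable_mult: "cancellable p \<Longrightarrow> cancellable q \<Longrightarrow> cancellable (p * q)"
  unfolding cancellable_def act_mult using bounded_act by (metis mult_eq_0_iff)

lemma expands_unique:
  assumes "expands f c" "expands f c'"
  shows "c = c'"
proof -
  obtain p q p' q' where *: "cancellable q" "f = Fract p q" "act q c = act p one_series"
    "cancellable q'" "f = Fract p' q'" "act q' c' = act p' one_series"
    and b: "bounded c" "bounded c'"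
    using assms unfolding expands_def by blast
  have eq: "p * q' = p' * q"
    using * by (auto simp: cancellable_def eq_fract)
  have "act (q * q') c = act (q' * p) one_series"
    using * act_commute by (simp add: act_mult)
  moreover have "act (q * q') c' = act (q * p') one_series"
    using * by (simp add: act_mult)
  ultimately have "act (q * q') (c - c') = 0"
    using eq by (simp add: act_diff_right mult.commute)
  then show ?thesis
    using cancellable_mult[OF *(1,4)] bounded_diff[OF b] unfolding cancellable_def by (metis right_minus_eq)
qed

lemma expands_0: "expands 0 0"
proof -
  have "act 1 0 = act 0 one_series" by simp
  then show ?thesis
    unfolding expands_def Zero_fract_def using cancellable_1 bounded_0 by blast
qed

lemma expands_eq_0: "expands f 0 \<Longrightarrow> f = 0"
  unfolding expands_def by (auto simp: Zero_fract_def eq_fract dest: act_one_series_eq_0 sym)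

lemma expands_mult_polynomial:
  assumes "expands f c" shows "expands (Fract r 1 * f) (act r c)"
proof -
  obtain p q where *: "cancellable q" "f = Fract p q" "act q c = act p one_series" "bounded c"
    using assms unfolding expands_def by blast
  have "act q (act r c) = act (r * p) one_series"
    using * act_commute[of q r] by (simp add: act_mult)
  then show ?thesis
    unfolding expands_def using * bounded_act by fastforce
qed

lemma expands_add:
  assumes "expands f c" "expands g c'" shows "expands (f + g) (c + c')"
proof -
  obtain p q p' q' where *: "cancellable q" "f = Fract p q" "act q c = act p one_series"
    "cancellable q'" "g = Fract p' q'" "act q' c' = act p' one_series"
    and b: "bounded c" "bounded c'"
    using assms unfolding expands_def by blast
  have nz: "q \<noteq> 0" "q' \<noteq> 0" using * by (auto simp: cancellable_def)
  have "act (q * q') c = act (q' * p) one_series"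
    using * act_commute by (simp add: act_mult)
  moreover have "act (q * q') c' = act (q * p') one_series"
    using * by (simp add: act_mult)
  ultimately have "act (q * q') (c + c') = act (p * q' + p' * q) one_series"
    by (simp add: act_add_right act_add_left mult.commute)
  moreover have "f + g = Fract (p * q' + p' * q) (q * q')"
    using * nz by simp
  ultimately show ?thesis
    unfolding expands_def using cancellable_mult[OF *(1,4)] bounded_add[OF b] by blast
qed

lemma expands_sum:
  assumes "finite A" "\<And>j. j \<in> A \<Longrightarrow> expands (f j) (c j)"
  shows "expands (\<Sum>j\<in>A. f j) (\<Sum>j\<in>A. c j)"
  using assms by (induction A rule: finite_induct) (auto intro: expands_0 expands_add)

text \<open>
  Differentiating \<open>q c = p\<close> and multiplying by \<open>q\<close> gives \<open>q\<^sup>2 c' = p' q - p q'\<close>.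
\<close>

lemma expands_pdiff:
  assumes "expands f c" shows "expands (pdiff j f) (sdiff j c)"
proof -
  obtain p q where *: "cancellable q" "f = Fract p q" "act q c = act p one_series" "bounded c"
    using assms unfolding expands_def by blast
  have nz: "q \<noteq> 0" using * by (auto simp: cancellable_def)
  have "act (poly_diff j q) c + act q (sdiff j c) = act (poly_diff j p) one_series"
    using sdiff_act[of j q c] sdiff_act[of j p one_series] *(3) by simp
  then have "act q (act (poly_diff j q) c + act q (sdiff j c)) = act (poly_diff j p * q) one_series"
    by (simp add: act_mult act_commute[of "poly_diff j p"])
  moreover have "act q (act (poly_diff j q) c) = act (p * poly_diff j q) one_series"
    using *(3) act_commute[of q "poly_diff j q" c] act_commute[of p "poly_diff j q" one_series]
    by (simp add: act_mult)
  ultimately have "act (q * q) (sdiff j c) = act (poly_diff j p * q - p * poly_diff j q) one_series"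
    by (simp add: act_add_right act_mult act_diff_left algebra_simps)
  moreover have "pdiff j f = Fract (poly_diff j p * q - p * poly_diff j q) (q * q)"
    using * nz by (simp add: pdiff_Fract)
  ultimately show ?thesis
    unfolding expands_def using cancellable_mult[OF *(1,1)] bounded_sdiff[OF *(4)] by blast
qed

lemma expands_scale:
  assumes "expands f c"
  shows "expands (of_int i * f) (\<lambda>u. of_int i * c u)"
proof -
  have "act (of_int i) c = (\<lambda>u. of_int i * c u)"
    by (simp only: act_single exponent_0 diff_zero flip: single_of_int)
  then show ?thesis
    using expands_mult_polynomial[OF assms, of "of_int i"] by (simp only: Fract_of_int_eq)
qed

lemma expands_var_mult:
  assumes "expands f c"
  shows "expands (var j * f) (\<lambda>u. c (u - unit_exponent j))"
  using expands_mult_polynomial[OF assms, of "Poly_Mapping.single (Poly_Mapping.single j 1) 1"]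
  by (simp add: var_def exponent_single_1)

lemma expands_euler:
  assumes "expands f c"
  shows "expands (var j * pdiff j f) (\<lambda>u. of_int (u j) * c u)"
  using expands_var_mult[OF expands_pdiff[OF assms, of j], of j]
  by (simp add: sdiff_def unit_exponent_def)

lemma expands_pdiff_power:
  assumes "expands f c"
  shows "expands ((pdiff j ^^ n) f)
    (\<lambda>u. of_int (pochhammer (u j + 1) n) * c (u + exponent_on {j} (\<lambda>_. n)))"
proof (induction n)
  case 0
  have "exponent_on {j} (\<lambda>_. 0) = 0" by (simp add: fun_eq_iff exponent_on_def)
  then show ?case using assms by simp
next
  case (Suc n)
  have 1: "u + unit_exponent j + exponent_on {j} (\<lambda>_. n) = u + exponent_on {j} (\<lambda>_. Suc n)" for u
    by (auto simp: fun_eq_iff unit_exponent_def exponent_on_def)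
  have 2: "(u + unit_exponent j) j = u j + 1" for u
    by (simp add: unit_exponent_def)
  have "sdiff j (\<lambda>u. of_int (pochhammer (u j + 1) n) * c (u + exponent_on {j} (\<lambda>_. n))) =
      (\<lambda>u. of_int (pochhammer (u j + 1) (Suc n)) * c (u + exponent_on {j} (\<lambda>_. Suc n)))"
    unfolding sdiff_def 1 2 pochhammer_rec of_int_mult mult.assoc ..
  then show ?case
    using expands_pdiff[OF Suc, of j] by (simp only: funpow.simps comp_apply)
qed

text \<open>
  All iterated derivatives act on coefficients by a shift and a product of rising factorials, which
  turns the box equations into recurrences.
\<close>

lemma expands_pdiff_monom:
  assumes "finite L" "expands f c"
  shows "expands (pdiff_monom L w f)
    (\<lambda>u. of_int (\<Prod>j\<in>L. pochhammer (u j + 1) (w j)) * c (u + exponent_on L w))"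
  using assms
proof (induction L rule: finite_induct)
  case empty
  have "exponent_on {} w = 0" by (simp add: fun_eq_iff exponent_on_def)
  then show ?case using empty by (simp add: pdiff_monom_empty)
next
  case (insert j L)
  have 1: "u + exponent_on {j} (\<lambda>_. w j) + exponent_on L w = u + exponent_on (insert j L) w" for u
    using insert.hyps by (auto simp: fun_eq_iff exponent_on_def)
  have 2: "(\<Prod>i\<in>L. pochhammer ((u + exponent_on {j} (\<lambda>_. w j)) i + 1) (w i)) =
      (\<Prod>i\<in>L. pochhammer (u i + 1) (w i))" for u
    using insert.hyps by (intro prod.cong) (auto simp: exponent_on_def)
  have "(\<lambda>u. of_int (pochhammer (u j + 1) (w j)) *
        (of_int (\<Prod>i\<in>L. pochhammer ((u + exponent_on {j} (\<lambda>_. w j)) i + 1) (w i)) *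
         c (u + exponent_on {j} (\<lambda>_. w j) + exponent_on L w))) =
      (\<lambda>u. of_int (\<Prod>i\<in>insert j L. pochhammer (u i + 1) (w i)) * c (u + exponent_on (insert j L) w))"
    unfolding 1 2 prod.insert[OF insert.hyps] of_int_mult mult.assoc ..
  then show ?case
    using expands_pdiff_power[OF insert.IH[OF insert.prems], where j = j and n = "w j"]
    by (simp only: pdiff_monom_insert[OF insert.hyps])
qed

definition leading :: "cpoly \<Rightarrow> (nat \<Rightarrow>\<^sub>0 nat) \<Rightarrow> bool" where
  "leading q \<mu> \<longleftrightarrow> \<mu> \<in> Poly_Mapping.keys q \<and>
     (\<forall>m\<in>Poly_Mapping.keys q - {\<mu>}. W (exponent m) < W (exponent \<mu>))"

text \<open>
  Since weights are integers bounded above on the support, one can argue from heavy exponents down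
  to light ones.
\<close>

lemma bounded_induct [consumes 1, case_names zero step]:
  assumes "bounded c"
    and zero: "\<And>u. c u = 0 \<Longrightarrow> P u"
    and step: "\<And>u. (\<And>v. W u < W v \<Longrightarrow> P v) \<Longrightarrow> P u"
  shows "P u"
proof -
  obtain N where N: "\<And>u. c u \<noteq> 0 \<Longrightarrow> W u \<le> N"
    using assms(1) unfolding bounded_def by blast
  show ?thesis
  proof (induction "nat (N + 1 - W u)" arbitrary: u rule: less_induct)
    case less
    show ?case
    proof (cases "W u \<le> N")
      case True
      show ?thesis
      proof (rule step)
        fix v assume "W u < W v"
        with True show "P v" by (intro less) auto
      qed
    next
      case False
      then show ?thesis using N zero by blast
    qed
  qed
qed

lemma act_leading:
  assumes "leading q \<mu>"
  shows "act q c (u + exponent \<mu>) = Poly_Mapping.lookup q \<mu> * c u +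
    (\<Sum>m\<in>Poly_Mapping.keys q - {\<mu>}. Poly_Mapping.lookup q m * c (u + exponent \<mu> - exponent m))"
  using assms unfolding act_def leading_def
  by (subst sum.remove[of _ \<mu>]) (auto simp del: plus_fun_apply minus_apply)

lemma W_tail:
  assumes "leading q \<mu>" "m \<in> Poly_Mapping.keys q - {\<mu>}"
  shows "W u < W (u + exponent \<mu> - exponent m)"
  using assms unfolding leading_def by (auto simp: W_add W_diff)

lemma lookup_leading: "leading q \<mu> \<Longrightarrow> Poly_Mapping.lookup q \<mu> \<noteq> 0"
  by (simp add: leading_def in_keys_iff)

text \<open>
  If \<open>q c = 0\<close>, then the coefficient of \<open>q c\<close> at \<open>u + exponent \<mu>\<close> expresses \<open>c u\<close> through coefficients
  of \<open>c\<close> at heavier exponents.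
\<close>

lemma leading_cancellable:
  assumes "leading q \<mu>"
  shows "cancellable q"
  unfolding cancellable_def
proof (intro conjI allI impI)
  show "q \<noteq> 0" using lookup_leading[OF assms] by auto
  fix c assume c: "bounded c" "act q c = 0"
  have "c u = 0" for u
    using c(1)
  proof (induction rule: bounded_induct)
    case (step u)
    have "(\<Sum>m\<in>Poly_Mapping.keys q - {\<mu>}. Poly_Mapping.lookup q m * c (u + exponent \<mu> - exponent m)) = 0"
      by (intro sum.neutral ballI) (simp only: step[OF W_tail[OF assms]] mult_zero_right)
    then show ?case
      using act_leading[OF assms, of c u] c(2) lookup_leading[OF assms] by simp
  qed simp
  then show "c = 0" by (simp add: fun_eq_iff)
qed

text \<open>
  The same formula solves \<open>q c = p\<close> recursively, starting with zero at all weights that are too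
  large to occur in \<open>p / q\<close>. This is the expansion of \<open>1 / q\<close> as a geometric series around its
  leading monomial.
\<close>

lemma expansion_exists:
  assumes lead: "leading q \<mu>" and L: "vars p \<subseteq> L" "vars q \<subseteq> L"
  obtains c where "bounded c" "\<And>u j. c u \<noteq> 0 \<Longrightarrow> j \<notin> L \<Longrightarrow> u j = 0"
    "act q c = act p one_series"
proof -
  define N where "N = Max (insert 0 ((\<lambda>m. W (exponent m) - W (exponent \<mu>)) ` Poly_Mapping.keys p))"
  define ok where "ok u \<longleftrightarrow> W u \<le> N \<and> (\<forall>j. j \<notin> L \<longrightarrow> u j = 0)" for u
  define step where "step g u = (if ok u then
      (act p one_series (u + exponent \<mu>) - (\<Sum>m\<in>Poly_Mapping.keys q - {\<mu>}.
         Poly_Mapping.lookup q m * g (u + exponent \<mu> - exponent m))) / Poly_Mapping.lookup q \<mu> else 0)"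
    for g :: series and u
  define R where "R = measure (\<lambda>u. nat (N + 1 - W u))"
  define c where "c = wfrec R step"
  have N: "W (exponent m) - W (exponent \<mu>) \<le> N" if "m \<in> Poly_Mapping.keys p" for m
    unfolding N_def using that by (intro Max_ge) auto
  have zero: "exponent m j = 0" if "m \<in> Poly_Mapping.keys r" "vars r \<subseteq> L" "j \<notin> L" for m r j
  proof -
    have "j \<notin> Poly_Mapping.keys m" using that unfolding vars_def by blast
    then show ?thesis by (simp add: exponent_def in_keys_iff)
  qed
  have \<mu>: "\<mu> \<in> Poly_Mapping.keys q" using lead by (simp add: leading_def)
  have c: "c u = step c u" for u
  proof -
    have "c u = step (cut c R u) u"
      unfolding c_def by (rule wfrec) (simp add: R_def)
    also have "\<dots> = step c u"
    proof (cases "ok u")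
      case True
      have "(u + exponent \<mu> - exponent m, u) \<in> R" if "m \<in> Poly_Mapping.keys q - {\<mu>}" for m
        using W_tail[OF lead that, of u] True unfolding R_def ok_def in_measure by linarith
      then have "(\<Sum>m\<in>Poly_Mapping.keys q - {\<mu>}. Poly_Mapping.lookup q m * cut c R u (u + exponent \<mu> - exponent m)) =
          (\<Sum>m\<in>Poly_Mapping.keys q - {\<mu>}. Poly_Mapping.lookup q m * c (u + exponent \<mu> - exponent m))"
        by (intro sum.cong refl) (simp only: cut_apply)
      then show ?thesis unfolding step_def by (simp only:)
    qed (simp add: step_def)
    finally show ?thesis .
  qed
  have supp: "ok u" if "c u \<noteq> 0" for u
    using that c[of u] by (auto simp: step_def split: if_splits)
  have "act q c (u + exponent \<mu>) = act p one_series (u + exponent \<mu>)" for u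
  proof (cases "ok u")
    case True
    then show ?thesis
      using c[of u] lookup_leading[OF lead] unfolding act_leading[OF lead] step_def
      by (simp del: plus_fun_apply minus_apply)
  next
    case False
    \<comment> \<open>Both sides vanish, since a nonzero contribution to either of them would make \<open>u\<close> admissible.\<close>
    have "act p one_series (u + exponent \<mu>) = 0"
    proof (rule ccontr)
      assume "act p one_series (u + exponent \<mu>) \<noteq> 0"
      then obtain m where m: "m \<in> Poly_Mapping.keys p" "u + exponent \<mu> = exponent m"
        by (rule act_one_series_neq_0E)
      have u: "u = exponent m - exponent \<mu>" unfolding m(2)[symmetric] by simp
      have "ok u"
        unfolding ok_def u W_diff using N[OF m(1)] zero[OF m(1) L(1)] zero[OF \<mu> L(2)] by simp
      with False show False by simp
    qed
    moreover have "c (u + exponent \<mu> - exponent m) = 0" if m: "m \<in> Poly_Mapping.keys q - {\<mu>}" for m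
    proof (rule ccontr)
      assume "c (u + exponent \<mu> - exponent m) \<noteq> 0"
      then have "ok (u + exponent \<mu> - exponent m)" by (rule supp)
      then have "ok u"
        using W_tail[OF lead m, of u] zero[of m q, OF _ L(2)] zero[OF \<mu> L(2)] m
        unfolding ok_def by simp
      with False show False by simp
    qed
    moreover have "c u = 0" using supp False by blast
    ultimately show ?thesis
      unfolding act_leading[OF lead] by (simp del: plus_fun_apply minus_apply)
  qed
  from this[of "u - exponent \<mu>" for u] have "act q c = act p one_series"
    by (simp add: fun_eq_iff del: plus_fun_apply minus_apply)
  moreover have "bounded c" "\<And>u j. c u \<noteq> 0 \<Longrightarrow> j \<notin> L \<Longrightarrow> u j = 0"
    using supp unfolding bounded_def ok_def by blast+
  ultimately show ?thesis using that by blast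
qed

end


section \<open>Denominators of rational expansions\<close>

text \<open>
  Extend \<open>a\<close> to a basis of the complex numbers over the rationals and read off its coordinate.
\<close>

lemma rat_functional_exists:
  fixes a :: complex assumes "a \<noteq> 0"
  obtains \<psi> :: "complex \<Rightarrow> complex"
  where "\<And>x y. \<psi> (x + y) = \<psi> x + \<psi> y" "\<And>r x. r \<in> \<rat> \<Longrightarrow> \<psi> (x * r) = \<psi> x * r"
    "\<And>x. \<psi> x \<in> \<rat>" "\<psi> a = 1"
proof -
  interpret vector_space "\<lambda>(r :: rat) (x :: complex). of_rat r * x"
    by unfold_locales (auto simp: algebra_simps of_rat_add of_rat_mult)
  have ind: "independent {a}" using assms by (simp add: independent_insert)
  define B where "B = extend_basis {a}"
  have B: "independent B" "span B = UNIV" "a \<in> B"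
    using independent_extend_basis[OF ind] span_extend_basis[OF ind] extend_basis_superset[OF ind]
    by (auto simp: B_def)
  define \<psi> :: "complex \<Rightarrow> complex" where "\<psi> x = of_rat (representation B x a)" for x
  show ?thesis
  proof
    show "\<psi> (x + y) = \<psi> x + \<psi> y" for x y
      unfolding \<psi>_def using B by (simp add: representation_add of_rat_add)
    show "\<psi> (x * r) = \<psi> x * r" if r_rat: "r \<in> \<rat>" for r x
    proof -
      obtain s where r: "r = of_rat s" using r_rat unfolding Rats_def by blast
      have "representation B (of_rat s * x) a = s * representation B x a"
        using B by (subst representation_scale) auto
      then show ?thesis
        unfolding \<psi>_def r by (metis of_rat_mult mult.commute)
    qed
    show "\<psi> x \<in> \<rat>" for x by (simp add: \<psi>_def)
    show "\<psi> a = 1" unfolding \<psi>_def using B by (simp add: representation_basis)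
  qed
qed

lemma common_denominator:
  assumes "finite A" "A \<subseteq> (\<rat> :: complex set)"
  obtains N :: nat where "N > 0" "\<And>a. a \<in> A \<Longrightarrow> of_nat N * a \<in> \<int>"
proof -
  have "\<exists>N::nat. N > 0 \<and> (\<forall>a\<in>A. of_nat N * a \<in> \<int>)"
    using assms
  proof (induction A rule: finite_induct)
    case (insert x A)
    then obtain N :: nat where N: "N > 0" "\<forall>a\<in>A. of_nat N * a \<in> \<int>" by auto
    obtain r where "x = of_rat r" using insert.prems unfolding Rats_def by blast
    then obtain p q where x: "q > 0" "x = of_int p / of_int q"
      by (cases r) (auto simp: of_rat_rat)
    have "of_nat (N * nat q) * a \<in> \<int>" if "a \<in> insert x A" for a
    proof (cases "a = x")
      case True
      then have "of_nat (N * nat q) * a = of_int (int N * p)" using x by simp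
      then show ?thesis by (metis Ints_of_int)
    next
      case False
      then have "of_nat N * a \<in> \<int>" using N that by auto
      then have "of_nat (nat q) * (of_nat N * a) \<in> \<int>" by (rule Ints_mult[OF Ints_of_nat])
      then show ?thesis by (simp add: algebra_simps)
    qed
    then show ?case using N x by (intro exI[of _ "N * nat q"]) auto
  qed (auto intro: exI[of _ 1])
  then show ?thesis using that by blast
qed

lemma Ints_sum_common_power:
  fixes f :: "'a \<Rightarrow> complex"
  assumes "finite A" "\<And>x. x \<in> A \<Longrightarrow> \<exists>e. of_nat N ^ e * f x \<in> \<int>"
  shows "\<exists>e. of_nat N ^ e * (\<Sum>x\<in>A. f x) \<in> \<int>"
  using assms
proof (induction A rule: finite_induct)
  case (insert x A)
  then obtain e e' where e: "of_nat N ^ e * f x \<in> \<int>" "of_nat N ^ e' * (\<Sum>x\<in>A. f x) \<in> \<int>" by blast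
  then have "of_nat N ^ e' * (of_nat N ^ e * f x) + of_nat N ^ e * (of_nat N ^ e' * (\<Sum>x\<in>A. f x)) \<in> \<int>"
    by (intro Ints_add Ints_mult[OF Ints_power[OF Ints_of_nat] e(1)] Ints_mult[OF Ints_power[OF Ints_of_nat] e(2)])
  then have "of_nat N ^ (e + e') * (\<Sum>x\<in>insert x A. f x) \<in> \<int>"
    using insert.hyps by (simp add: algebra_simps power_add)
  then show ?case by blast
qed auto

context weight
begin

text \<open>
  A version of Eisenstein's observation that a rational function with rational Taylor coefficients
  involves only finitely many primes in their denominators. The coefficients of \<open>p\<close> and \<open>q\<close> may
  be transcendental, but as \<open>c\<close> is rational, applying a rational-linear functional to them
  preserves \<open>q c = p\<close>. Afterwards they are rational, \<open>q\<close> is monic at its leading monomial, and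
  the recursion for \<open>c\<close> creates no primes beyond those of finitely many denominators.
\<close>

lemma denominators_of_rational_expansion:
  assumes lead: "leading q \<mu>" and c: "bounded c" "act q c = act p one_series"
    and rat: "\<And>u. c u \<in> \<rat>"
  obtains N :: nat where "N > 0" "\<And>u. \<exists>e. of_nat N ^ e * c u \<in> \<int>"
proof -
  obtain \<psi> where \<psi>: "\<And>x y. \<psi> (x + y) = \<psi> x + \<psi> y" "\<And>r x. r \<in> \<rat> \<Longrightarrow> \<psi> (x * r) = \<psi> x * r"
    "\<And>x. \<psi> x \<in> \<rat>" "\<psi> (Poly_Mapping.lookup q \<mu>) = 1"
    using rat_functional_exists[OF lookup_leading[OF lead]] by metis
  have \<psi>_0: "\<psi> 0 = 0" using \<psi>(1)[of 0 0] by simp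
  have \<psi>_sum: "\<psi> (\<Sum>x\<in>A. f x) = (\<Sum>x\<in>A. \<psi> (f x))" for A :: "(nat \<Rightarrow>\<^sub>0 nat) set" and f
    by (induction A rule: infinite_finite_induct) (auto simp: \<psi>_0 \<psi>(1))
  obtain N :: nat where N: "N > 0"
    "\<And>a. a \<in> (\<lambda>m. \<psi> (Poly_Mapping.lookup q m)) ` Poly_Mapping.keys q \<union>
      (\<lambda>m. \<psi> (Poly_Mapping.lookup p m)) ` Poly_Mapping.keys p \<Longrightarrow> of_nat N * a \<in> \<int>"
    by (rule common_denominator[of "(\<lambda>m. \<psi> (Poly_Mapping.lookup q m)) ` Poly_Mapping.keys q \<union>
      (\<lambda>m. \<psi> (Poly_Mapping.lookup p m)) ` Poly_Mapping.keys p"]) (auto simp: \<psi>(3))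
  have "\<exists>e. of_nat N ^ e * c u \<in> \<int>" for u
    using c(1)
  proof (induction rule: bounded_induct)
    case (step u)
    let ?K = "Poly_Mapping.keys q - {\<mu>}"
    let ?t = "u + exponent \<mu>"
    let ?P = "\<Sum>m\<in>Poly_Mapping.keys p. \<psi> (Poly_Mapping.lookup p m) * one_series (?t - exponent m)"
    let ?S = "\<Sum>m\<in>?K. \<psi> (Poly_Mapping.lookup q m) * c (?t - exponent m)"
    have "\<psi> (act q c ?t) = c u + ?S"
      unfolding act_leading[OF lead] \<psi>(1) \<psi>_sum \<psi>(2)[OF rat] \<psi>(4) by simp
    moreover have one: "one_series t \<in> \<rat>" for t by (simp add: one_series_def)
    have "\<psi> (act p one_series ?t) = ?P"
      unfolding act_def \<psi>_sum \<psi>(2)[OF one] ..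
    ultimately have cu: "c u = ?P + (-1) * ?S"
      using c(2) by (simp add: algebra_simps)
    have "of_nat N * ?P = (\<Sum>m\<in>Poly_Mapping.keys p. (of_nat N * \<psi> (Poly_Mapping.lookup p m)) * one_series (?t - exponent m))"
      unfolding sum_distrib_left mult.assoc ..
    also have "\<dots> \<in> \<int>"
      by (rule Ints_sum, rule Ints_mult) (auto intro: N(2) simp: one_series_def)
    finally have P: "of_nat N * ?P \<in> \<int>" .
    have "\<exists>e. of_nat N ^ e * (\<psi> (Poly_Mapping.lookup q m) * c (?t - exponent m)) \<in> \<int>" if m: "m \<in> ?K" for m
    proof -
      obtain e where e: "of_nat N ^ e * c (?t - exponent m) \<in> \<int>"
        using step[OF W_tail[OF lead m]] by blast
      have "of_nat N * \<psi> (Poly_Mapping.lookup q m) \<in> \<int>" using m N(2) by blast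
      from Ints_mult[OF this e] have "of_nat N ^ Suc e * (\<psi> (Poly_Mapping.lookup q m) * c (?t - exponent m)) \<in> \<int>"
        by (simp only: power_Suc mult_ac)
      then show ?thesis by blast
    qed
    then have "\<exists>e. of_nat N ^ e * ?S \<in> \<int>"
      by (rule Ints_sum_common_power[OF finite_Diff[OF finite_keys]])
    then obtain e where S: "of_nat N ^ e * ?S \<in> \<int>" by blast
    have "of_nat N ^ e * (of_nat N * ?P) + of_int (- int N) * (of_nat N ^ e * ?S) \<in> \<int>"
      by (intro Ints_add Ints_mult[OF Ints_power[OF Ints_of_nat] P] Ints_mult[OF Ints_of_int S])
    also have "of_nat N ^ e * (of_nat N * ?P) + of_int (- int N) * (of_nat N ^ e * ?S) = of_nat N ^ Suc e * (?P + (-1) * ?S)"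
      by (simp only: power_Suc of_int_minus of_int_of_nat_eq) (simp only: distrib_left mult_minus_left mult_ac mult_1 mult_minus_right)
    finally have "of_nat N ^ Suc e * c u \<in> \<int>" by (simp only: cu)
    then show ?case by blast
  qed auto
  with N(1) show ?thesis using that by blast
qed

end


section \<open>Series solutions of the hypergeometric system\<close>

text \<open>
  For \<open>v \<in> A_kernel L\<close>, the box equation at \<open>v\<close> compares the coefficients at \<open>u\<close> and \<open>u + v\<close>. The
  lowering factor comes from the derivatives in the variables whose exponent decreases from \<open>u\<close> to
  \<open>u + v\<close>; the raising factor, from the others, belongs to the coefficient at \<open>u + v\<close>.
\<close>

definition lowering_factor :: "nat set \<Rightarrow> (nat \<Rightarrow> int) \<Rightarrow> (nat \<Rightarrow> int) \<Rightarrow> int" where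
  "lowering_factor L u v = (\<Prod>j\<in>L. pochhammer (u j + 1 - int (nat (- v j))) (nat (- v j)))"

definition raising_factor :: "nat set \<Rightarrow> (nat \<Rightarrow> int) \<Rightarrow> (nat \<Rightarrow> int) \<Rightarrow> int" where
  "raising_factor L u v = (\<Prod>j\<in>L. pochhammer (u j + 1) (nat (v j)))"

lemma A_kernel_iff: "v \<in> A_kernel L \<longleftrightarrow> (\<Sum>j\<in>L. v j) = 0 \<and> (\<Sum>j\<in>L. int j * v j) = 0"
  by (simp add: A_kernel_def A_mat_def)

lemma pochhammer_int_eq_0_iff: "pochhammer (a :: int) n = 0 \<longleftrightarrow> (\<exists>k<n. a = - int k)"
  by (auto simp: pochhammer_prod eq_neg_iff_add_eq_0)

text \<open>
  Lowering a nonnegative exponent by differentiation gives zero exactly if the exponent becomes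
  negative; a negative exponent can always be lowered. The raising factor is the same with the roles of
  \<open>u\<close> and \<open>u + v\<close> exchanged.
\<close>

lemma lowering_factor_nonzero:
  assumes "\<And>j. j \<in> L \<Longrightarrow> 0 \<le> u j \<Longrightarrow> 0 \<le> u j + v j"
  shows "lowering_factor L u v \<noteq> 0"
proof (cases "finite L")
  case True
  have "pochhammer (u j + 1 - int (nat (- v j))) (nat (- v j)) \<noteq> 0" if "j \<in> L" for j
    unfolding pochhammer_int_eq_0_iff using assms[OF that] by (cases "0 \<le> u j") auto
  then show ?thesis using True unfolding lowering_factor_def by simp
qed (simp add: lowering_factor_def)

lemma raising_factor_nonzero:
  assumes "\<And>j. j \<in> L \<Longrightarrow> u j < 0 \<Longrightarrow> u j + v j < 0"
  shows "raising_factor L u v \<noteq> 0"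
proof (cases "finite L")
  case True
  have "pochhammer (u j + 1) (nat (v j)) \<noteq> 0" if "j \<in> L" for j
    unfolding pochhammer_int_eq_0_iff using assms[OF that] by (cases "u j < 0") auto
  then show ?thesis using True unfolding raising_factor_def by simp
qed (simp add: raising_factor_def)

text \<open>
  What remains of the hypergeometric system on the level of coefficients. Since
  \<^const>\<open>A_kernel\<close> does not constrain vectors outside of \<open>L\<close>, the recurrence is stated for those
  that vanish there.
\<close>

locale hypergeometric_series = weight W for W +
  fixes L :: "nat set" and \<alpha>\<^sub>1 \<alpha>\<^sub>2 :: int and c :: series
  assumes finite_L: "finite L"
    and bounded_c: "bounded c"
    and support_L: "c u \<noteq> 0 \<Longrightarrow> j \<notin> L \<Longrightarrow> u j = 0"
    and euler: "c u \<noteq> 0 \<Longrightarrow> (\<Sum>j\<in>L. u j) = \<alpha>\<^sub>1" "c u \<noteq> 0 \<Longrightarrow> (\<Sum>j\<in>L. int j * u j) = \<alpha>\<^sub>2"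
    and box: "v \<in> A_kernel L \<Longrightarrow> (\<And>j. j \<notin> L \<Longrightarrow> v j = 0) \<Longrightarrow>
      of_int (lowering_factor L u v) * c u = of_int (raising_factor L u v) * c (u + v)"

lemma (in weight) expansion_is_hypergeometric_series:
  assumes L: "finite L" and f: "expands f c" "A_hypergeometric L (\<alpha>\<^sub>1, \<alpha>\<^sub>2) f"
    and supp: "\<And>u j. c u \<noteq> 0 \<Longrightarrow> j \<notin> L \<Longrightarrow> u j = 0"
  shows "hypergeometric_series W L \<alpha>\<^sub>1 \<alpha>\<^sub>2 c"
proof
  show "finite L" by fact
  show "bounded c" using f(1) by (simp add: expands_def)
  show "u j = 0" if "c u \<noteq> 0" "j \<notin> L" for u j using supp that .
  show "(\<Sum>j\<in>L. u j) = \<alpha>\<^sub>1" if "c u \<noteq> 0" for u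
  proof -
    have "expands (\<Sum>j\<in>L. var j * pdiff j f) (\<Sum>j\<in>L. (\<lambda>u. of_int (u j) * c u))"
      by (rule expands_sum[OF L expands_euler[OF f(1)]])
    then have "expands (of_int \<alpha>\<^sub>1 * f) (\<Sum>j\<in>L. (\<lambda>u. of_int (u j) * c u))"
      using f(2) unfolding A_hypergeometric_def fst_conv by metis
    from expands_unique[OF expands_scale[OF f(1)] this]
    have "of_int \<alpha>\<^sub>1 * c u = (\<Sum>j\<in>L. (\<lambda>u. of_int (u j) * c u)) u" by (rule fun_cong)
    also have "\<dots> = of_int (\<Sum>j\<in>L. u j) * c u"
      using L by (induction L rule: finite_induct) (auto simp: algebra_simps)
    finally show ?thesis using that by (metis mult_right_cancel of_int_eq_iff)
  qed
  show "(\<Sum>j\<in>L. int j * u j) = \<alpha>\<^sub>2" if "c u \<noteq> 0" for u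
  proof -
    have "expands (of_nat j * var j * pdiff j f) (\<lambda>u. of_int (int j) * (of_int (u j) * c u))" for j
      using expands_scale[OF expands_euler[OF f(1), of j], of "int j"]
      by (simp only: mult.assoc of_int_of_nat_eq)
    then have "expands (\<Sum>j\<in>L. of_nat j * var j * pdiff j f)
        (\<Sum>j\<in>L. (\<lambda>u. of_int (int j) * (of_int (u j) * c u)))"
      by (intro expands_sum[OF L])
    then have "expands (of_int \<alpha>\<^sub>2 * f) (\<Sum>j\<in>L. (\<lambda>u. of_int (int j) * (of_int (u j) * c u)))"
      using f(2) unfolding A_hypergeometric_def snd_conv by metis
    from expands_unique[OF expands_scale[OF f(1)] this]
    have "of_int \<alpha>\<^sub>2 * c u = (\<Sum>j\<in>L. (\<lambda>u. of_int (int j) * (of_int (u j) * c u))) u"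
      by (rule fun_cong)
    also have "\<dots> = of_int (\<Sum>j\<in>L. int j * u j) * c u"
      using L by (induction L rule: finite_induct) (auto simp: algebra_simps)
    finally show ?thesis using that by (metis mult_right_cancel of_int_eq_iff)
  qed
  show "of_int (lowering_factor L u v) * c u = of_int (raising_factor L u v) * c (u + v)"
    if v: "v \<in> A_kernel L" "\<And>j. j \<notin> L \<Longrightarrow> v j = 0" for u v
  proof -
    let ?p = "\<lambda>j. nat (v j)" and ?n = "\<lambda>j. nat (- v j)"
    let ?t = "u - exponent_on L ?n"
    have "pdiff_monom L ?p f = pdiff_monom L ?n f"
      using f(2) v(1) unfolding A_hypergeometric_def by simp
    note expands_unique[OF expands_pdiff_monom[OF L f(1), of ?p, unfolded this]
        expands_pdiff_monom[OF L f(1), of ?n]]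
    then have "(\<lambda>u. of_int (\<Prod>j\<in>L. pochhammer (u j + 1) (?p j)) * c (u + exponent_on L ?p)) =
        (\<lambda>u. of_int (\<Prod>j\<in>L. pochhammer (u j + 1) (?n j)) * c (u + exponent_on L ?n))"
      .
    then have "of_int (\<Prod>j\<in>L. pochhammer (?t j + 1) (?p j)) * c (?t + exponent_on L ?p) =
        of_int (\<Prod>j\<in>L. pochhammer (?t j + 1) (?n j)) * c (?t + exponent_on L ?n)"
      by (rule fun_cong)
    moreover have "?t + exponent_on L ?p = u + v" "?t + exponent_on L ?n = u"
      using v(2) by (auto simp: fun_eq_iff exponent_on_def)
    moreover have "(\<Prod>j\<in>L. pochhammer (?t j + 1) (?n j)) = lowering_factor L u v"
      unfolding lowering_factor_def by (intro prod.cong) (auto simp: exponent_on_def algebra_simps)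
    moreover have "(\<Prod>j\<in>L. pochhammer (?t j + 1) (?p j)) = raising_factor L u v"
      unfolding raising_factor_def
    proof (intro prod.cong refl)
      fix j assume "j \<in> L"
      then show "pochhammer (?t j + 1) (?p j) = pochhammer (u j + 1) (?p j)"
        by (cases "v j \<le> 0") (auto simp: exponent_on_def)
    qed
    ultimately show ?thesis by metis
  qed
qed

text \<open>
  The linear relation between the columns of the matrix with indices \<open>0\<close>, \<open>j\<close> and \<open>d\<close>.
\<close>

definition circuit :: "nat \<Rightarrow> nat \<Rightarrow> nat \<Rightarrow> int" where
  "circuit d j = (\<lambda>i. (if i = 0 then int d - int j else 0) + (if i = j then - int d else 0) +
     (if i = d then int j else 0))"

lemma circuit_in_A_kernel:
  assumes "finite L" "0 \<in> L" "j \<in> L" "d \<in> L"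
  shows "(\<lambda>i. a * circuit d j i) \<in> A_kernel L"
proof -
  have "(\<Sum>i\<in>L. circuit d j i) = 0"
    unfolding circuit_def using assms by (simp add: sum.distrib)
  moreover have "(\<Sum>i\<in>L. int i * circuit d j i) =
      (\<Sum>i\<in>L. (if i = j then int j * - int d else 0) + (if i = d then int d * int j else 0))"
    by (intro sum.cong) (auto simp: circuit_def)
  then have "(\<Sum>i\<in>L. int i * circuit d j i) = 0"
    using assms by (simp add: sum.distrib)
  moreover have "(\<Sum>i\<in>L. int i * (a * circuit d j i)) = a * (\<Sum>i\<in>L. int i * circuit d j i)"
    by (simp add: sum_distrib_left mult_ac)
  ultimately show ?thesis
    by (simp add: A_kernel_iff flip: sum_distrib_left)
qed

context hypergeometric_series
begin

text \<open>
  If no exponent changes from nonnegative to negative, then the lowering factor is nonzero and the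
  recurrence forces the coefficient at \<open>u + v\<close> to be nonzero.
\<close>

lemma support_closed_under_moves:
  assumes "c u \<noteq> 0" "v \<in> A_kernel L" "\<And>j. j \<notin> L \<Longrightarrow> v j = 0"
    and "\<And>j. j \<in> L \<Longrightarrow> 0 \<le> u j \<Longrightarrow> 0 \<le> u j + v j"
  shows "c (u + v) \<noteq> 0"
  using box[OF assms(2,3), of u] lowering_factor_nonzero[OF assms(4), of L] assms(1) by auto

text \<open>
  If no exponent changes from negative to nonnegative, then the raising factor is nonzero and the
  recurrence determines the coefficient at \<open>u'\<close>.
\<close>

lemma support_ratio_rational:
  assumes "c u \<noteq> 0" "\<And>j. j \<in> L \<Longrightarrow> u j < 0 \<Longrightarrow> u' j < 0"
  shows "c u' / c u \<in> \<rat>"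
proof (cases "c u' = 0")
  case False
  let ?v = "u' - u"
  have "?v \<in> A_kernel L"
    unfolding A_kernel_iff using euler[OF assms(1)] euler[OF False]
    by (simp add: sum_subtractf algebra_simps)
  moreover have "?v j = 0" if "j \<notin> L" for j
    using support_L[OF assms(1) that] support_L[OF False that] by simp
  ultimately have "of_int (lowering_factor L u ?v) * c u = of_int (raising_factor L u ?v) * c u'"
    using box[of ?v u] by simp
  moreover have "raising_factor L u ?v \<noteq> 0"
    by (rule raising_factor_nonzero) (use assms(2) in auto)
  ultimately have "c u' / c u = of_int (lowering_factor L u ?v) / of_int (raising_factor L u ?v)"
    using assms(1) by (simp add: field_simps)
  then show ?thesis by simp
qed simp

end

text \<open>
  The positivity condition says that the weight of the \<open>j\<close>-th variable lies below the chord joining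
  those of the variables \<open>0\<close> and \<open>d\<close>, so that \<open>x\<^sub>0\<close> and \<open>x\<^sub>d\<close> dominate the expansion.
\<close>

locale convex_weight_series = hypergeometric_series +
  fixes d :: nat
  assumes L_subset: "L \<subseteq> {0..d}" and endpoints: "0 \<in> L" "d \<in> L"
    and circuit_pos: "j \<in> L \<Longrightarrow> 0 < j \<Longrightarrow> j < d \<Longrightarrow> 0 < W (circuit d j)"
    and euler_jacobi: "int d * \<alpha>\<^sub>1 < \<alpha>\<^sub>2" "\<alpha>\<^sub>2 < 0"
begin

text \<open>
  With a negative exponent at \<open>j\<close>, one could add the circuit arbitrarily often without leaving the
  support: no exponent but the one at \<open>j\<close> is lowered. As the circuit has positive weight, this
  contradicts boundedness.
\<close>

lemma support_interior_nonneg: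
  assumes "c u \<noteq> 0" "j \<in> L" "0 < j" "j < d"
  shows "0 \<le> u j"
proof (rule ccontr)
  assume neg: "\<not> 0 \<le> u j"
  obtain N where N: "\<And>u. c u \<noteq> 0 \<Longrightarrow> W u \<le> N"
    using bounded_c unfolding bounded_def by blast
  define n where "n = nat (N - W u) + 1"
  let ?v = "\<lambda>i. int n * circuit d j i"
  have "c (u + ?v) \<noteq> 0"
  proof (rule support_closed_under_moves[OF assms(1)])
    show "?v \<in> A_kernel L"
      using finite_L endpoints assms by (intro circuit_in_A_kernel)
    show "?v i = 0" if "i \<notin> L" for i
      using that endpoints assms by (auto simp: circuit_def)
    show "0 \<le> u i + ?v i" if "0 \<le> u i" for i
      using that neg assms by (auto simp: circuit_def)
  qed
  then have "W u + int n * W (circuit d j) \<le> N"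
    using N by (metis W_add W_multiple)
  moreover have "int n \<le> int n * W (circuit d j)"
    using circuit_pos[OF assms(2-4)] mult_left_mono[of 1 "W (circuit d j)" "int n"] by simp
  moreover have "N < W u + int n" by (simp add: n_def)
  ultimately show False by linarith
qed

lemma d_pos: "0 < d"
  using euler_jacobi by (cases d) auto

text \<open>
  The Euler equations give \<open>\<Sum>j. j u\<^sub>j = \<alpha>\<^sub>2 < 0\<close> and \<open>\<Sum>j. (d - j) u\<^sub>j = d \<alpha>\<^sub>1 - \<alpha>\<^sub>2 < 0\<close>. In each sum
  the interior terms are nonnegative and only one of the two end terms occurs.
\<close>

lemma support_endpoints_negative:
  assumes "c u \<noteq> 0"
  shows "u 0 < 0" "u d < 0"
proof -
  note nonneg = support_interior_nonneg[OF assms]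
  have range: "j < d" if "j \<in> L - {d}" for j using that L_subset by force
  have "0 \<le> int j * u j" if "j \<in> L - {d}" for j
    using range[of j] nonneg[of j] that by (cases "j = 0") auto
  then have "0 \<le> (\<Sum>j\<in>L - {d}. int j * u j)"
    by (rule sum_nonneg)
  moreover have "(\<Sum>j\<in>L. int j * u j) = int d * u d + (\<Sum>j\<in>L - {d}. int j * u j)"
    using finite_L endpoints by (subst sum.remove[of _ d]) auto
  ultimately have "int d * u d < 0"
    using euler(2)[OF assms] euler_jacobi by linarith
  then show "u d < 0" by (simp add: mult_less_0_iff)
  have "0 \<le> (int d - int j) * u j" if "j \<in> L - {0}" for j
    using range[of j] nonneg[of j] that by (cases "j = d") auto
  then have "0 \<le> (\<Sum>j\<in>L - {0}. (int d - int j) * u j)"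
    by (rule sum_nonneg)
  moreover have "(\<Sum>j\<in>L. (int d - int j) * u j) = int d * u 0 + (\<Sum>j\<in>L - {0}. (int d - int j) * u j)"
    using finite_L endpoints by (subst sum.remove[of _ 0]) auto
  moreover have "(\<Sum>j\<in>L. (int d - int j) * u j) = int d * \<alpha>\<^sub>1 - \<alpha>\<^sub>2"
    using euler[OF assms] by (simp add: left_diff_distrib sum_subtractf flip: sum_distrib_left)
  ultimately have "int d * u 0 < 0"
    using euler_jacobi by linarith
  then show "u 0 < 0" by (simp add: mult_less_0_iff)
qed

lemma ratio_rational:
  assumes "c u \<noteq> 0"
  shows "c u' / c u \<in> \<rat>"
proof (cases "c u' = 0")
  case False
  show ?thesis
  proof (rule support_ratio_rational[OF assms])
    fix j assume "j \<in> L" "u j < 0"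
    moreover have "j \<le> d" using L_subset \<open>j \<in> L\<close> by auto
    ultimately have "j = 0 \<or> j = d"
      using support_interior_nonneg[OF assms, of j] by force
    then show "u' j < 0" using support_endpoints_negative[OF False] by blast
  qed
qed simp

text \<open>
  Going \<open>n\<close> steps against the circuit multiplies the coefficient by \<open>F / G\<close>, where \<open>G\<close> is the product
  of \<open>n d\<close> consecutive integers starting at \<open>u\<^sub>j + 1\<close>, while \<open>F\<close> is, up to sign, the product of two runs of \<open>n (d - j)\<close>
  and \<open>n j\<close> consecutive integers, starting at \<open>- u\<^sub>0\<close> and \<open>- u\<^sub>d\<close>. For a large prime \<open>l\<close> and \<open>n\<close> close to
  \<open>l / d\<close>, the first run reaches \<open>l\<close> and the two others end before it.
\<close>

lemma large_prime_denominator: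
  assumes u: "c u \<noteq> 0" and j: "j \<in> L" "0 < j" "j < d"
  obtains l F G u' where "prime l" "l > K" "int l dvd G" "\<not> int l dvd F"
    "of_int F * c u = of_int G * c u'"
proof -
  have u0: "u 0 < 0" "u d < 0" using support_endpoints_negative[OF u] by auto
  have uj: "0 \<le> u j" using support_interior_nonneg[OF u j] .
  obtain l where l: "prime l" "l > K + d * d + d * nat (- u 0) + d * nat (- u d) + nat (u j)"
    using bigger_prime by blast
  \<comment> \<open>The least \<open>n\<close> with \<open>l < n * d\<close>.\<close>
  define n where "n = l div d + 1"
  have n: "l < n * d" "n * d \<le> l + d"
  proof -
    show "l < n * d" unfolding n_def using d_pos dividend_less_div_times[of d l] by (simp add: add.commute)
    have "l div d * d \<le> l" by simp
    then show "n * d \<le> l + d" unfolding n_def by simp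
  qed
  define v where "v = (\<lambda>i. - int n * circuit d j i)"
  have val: "v 0 = - int (n * (d - j))" "v d = - int (n * j)" "v j = int (n * d)"
    "\<And>i. i \<noteq> 0 \<Longrightarrow> i \<noteq> d \<Longrightarrow> i \<noteq> j \<Longrightarrow> v i = 0"
    using j by (auto simp: v_def circuit_def of_nat_diff)
  have "v \<in> A_kernel L"
    unfolding v_def using finite_L endpoints j by (intro circuit_in_A_kernel)
  moreover have "v i = 0" if "i \<notin> L" for i
    using that endpoints j by (auto simp: v_def circuit_def)
  ultimately have "of_int (lowering_factor L u v) * c u = of_int (raising_factor L u v) * c (u + v)"
    by (rule box)
  moreover have "int l dvd raising_factor L u v"
  proof -
    have "int l dvd pochhammer (u j + 1) (nat (v j))"
    proof -
      define i where "i = nat (int l - u j - 1)"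
      have "int l = u j + 1 + int i" "i < n * d"
        using l(2) n uj by (auto simp: i_def)
      moreover have "u j + 1 + int i dvd (\<Prod>i = 0..<n * d. u j + 1 + int i)"
        by (rule dvd_prodI) (use \<open>i < n * d\<close> in auto)
      ultimately show ?thesis
        unfolding val pochhammer_prod nat_int by simp
    qed
    also have "\<dots> dvd raising_factor L u v"
      unfolding raising_factor_def by (rule dvd_prodI[OF finite_L j(1)])
    finally show ?thesis .
  qed
  moreover have "\<not> int l dvd lowering_factor L u v"
  proof
    assume "int l dvd lowering_factor L u v"
    then obtain i t where it: "i \<in> L" "t < nat (- v i)"
      "int l dvd u i + 1 - int (nat (- v i)) + int t"
      using l(1) finite_L unfolding lowering_factor_def pochhammer_prod
      by (auto simp: prime_dvd_prod_iff)
    have small: "int (n * e) - u i < int l" if "e < d" "u i < 0" "d * nat (- u i) + d * d < l" for e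
    proof -
      have "n * e + n \<le> n * d" using mult_le_mono2[of "Suc e" d n] \<open>e < d\<close> by simp
      moreover have "nat (- u i) + d < n"
      proof (rule ccontr)
        assume "\<not> nat (- u i) + d < n"
        then have "n * d \<le> (nat (- u i) + d) * d" by (intro mult_le_mono1) simp
        with n that(3) show False by (simp add: algebra_simps)
      qed
      ultimately show ?thesis using n that(2) by linarith
    qed
    have "i = 0 \<or> i = d"
    proof (rule ccontr)
      assume "\<not> (i = 0 \<or> i = d)"
      then have "nat (- v i) = 0" using val by (cases "i = j") auto
      with it(2) show False by simp
    qed
    then have "u i < 0 \<and> int (nat (- v i)) - u i < int l"
    proof
      assume i: "i = 0"
      have "nat (- v i) = n * (d - j)" unfolding i val minus_minus nat_int ..
      moreover have "int (n * (d - j)) - u i < int l"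
      proof (rule small)
        show "d - j < d" "u i < 0" using i u0 j by auto
        show "d * nat (- u i) + d * d < l" unfolding i using l(2) by linarith
      qed
      ultimately show ?thesis using i u0 by simp
    next
      assume i: "i = d"
      have "nat (- v i) = n * j" unfolding i val minus_minus nat_int ..
      moreover have "int (n * j) - u i < int l"
      proof (rule small)
        show "j < d" "u i < 0" using i u0 j by auto
        show "d * nat (- u i) + d * d < l" unfolding i using l(2) by linarith
      qed
      ultimately show ?thesis using i u0 by simp
    qed
    then have "- int l < u i + 1 - int (nat (- v i)) + int t" "u i + 1 - int (nat (- v i)) + int t < 0"
      using it(2) by linarith+
    with it(3) show False
      using zdvd_imp_le[of "int l" "- (u i + 1 - int (nat (- v i)) + int t)"] by (simp add: dvd_minus_iff del: minus_add_distrib)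
  qed
  ultimately show ?thesis
    using that[of l "raising_factor L u v" "lowering_factor L u v" "u + v"] l by auto
qed

lemma not_expansion_of_rational_function:
  assumes "leading q \<mu>" "act q c = act p one_series" and j: "j \<in> L" "0 < j" "j < d"
  shows "c u = 0"
proof (rule ccontr)
  assume u: "c u \<noteq> 0"
  let ?c = "\<lambda>u'. inverse (c u) * c u'"
  have b: "bounded ?c"
    using bounded_scaled_shift[OF bounded_c, of "\<lambda>_. inverse (c u)" 0] by simp
  have act: "act q ?c = act (Poly_Mapping.single 0 (inverse (c u)) * p) one_series"
    unfolding act_scale_right act_mult assms(2) act_single exponent_0 diff_zero ..
  have rat: "?c u' \<in> \<rat>" for u'
    using ratio_rational[OF u, of u'] by (simp add: field_simps)
  obtain N :: nat where N: "N > 0" "\<And>u'. \<exists>e. of_nat N ^ e * ?c u' \<in> \<int>"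
    by (rule denominators_of_rational_expansion[OF assms(1) b act rat]) (rule that)
  obtain l F G u' where l: "prime l" "l > N" "int l dvd G" "\<not> int l dvd F"
    "of_int F * c u = of_int G * c u'"
    by (rule large_prime_denominator[OF u j, where K = N]) (rule that)
  obtain e z where z: "of_nat N ^ e * ?c u' = of_int z"
    using N(2)[of u'] by (auto elim: Ints_cases)
  have "of_int (int N ^ e * F) = (of_int (G * z) :: complex)"
  proof -
    have "of_int F = of_int G * ?c u'" using l(5) u by (simp add: field_simps)
    then show ?thesis using z by (simp add: mult_ac)
  qed
  then have "int N ^ e * F = G * z" by (simp only: of_int_eq_iff)
  with l(3) have "int l dvd int N ^ e * F" by simp
  with l(1,4) have "int l dvd int N"
    using prime_dvd_multD[of "int l"] prime_dvd_power[of "int l"] by (metis prime_nat_int_transfer)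
  then have "l dvd N" by simp
  then have "l \<le> N" using N(1) by (rule dvd_imp_le)
  with l(2) show False by simp
qed

end


section \<open>A convex weight separating the monomials of the denominator\<close>

text \<open>
  With differences of digits as coefficients, this is the uniqueness of representations in base \<open>B\<close>.
\<close>

lemma base_representation_zero:
  fixes x :: "nat \<Rightarrow> int"
  assumes "(\<Sum>j\<le>d. x j * B ^ j) = 0" "\<And>j. \<bar>x j\<bar> < B" "j \<le> d"
  shows "x j = 0"
  using assms
proof (induction d arbitrary: x j)
  case 0
  then show ?case by simp
next
  case (Suc d)
  have sum: "(\<Sum>j\<le>Suc d. x j * B ^ j) = x 0 + B * (\<Sum>j\<le>d. x (Suc j) * B ^ j)"
    by (subst sum.atMost_Suc_shift) (simp add: sum_distrib_left mult_ac)
  then have "B dvd x 0"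
    using Suc.prems(1) by (metis add.commute add_eq_0_iff dvd_minus_iff dvd_triv_left)
  then have x0: "x 0 = 0"
    using Suc.prems(2)[of 0] zdvd_not_zless[of "\<bar>x 0\<bar>" B] by force
  have "B \<noteq> 0" using Suc.prems(2)[of 0] by auto
  then have "(\<Sum>j\<le>d. x (Suc j) * B ^ j) = 0"
    using sum x0 Suc.prems(1) by simp
  from Suc.IH[of "\<lambda>j. x (Suc j)", OF this] x0 show ?case
    using Suc.prems by (cases j) auto
qed

theorem theorem1p9:
  fixes m d :: nat and k :: "nat \<Rightarrow> nat" and \<alpha>\<^sub>1 \<alpha>\<^sub>2 :: int
  assumes "m \<ge> 1"
    and "0 < k 1" and "strict_mono_on {1..m} k" and "k m < d"
    and "Gcd (k ` {1..m} \<union> {d}) = 1"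
    and "int d * \<alpha>\<^sub>1 < \<alpha>\<^sub>2" and "\<alpha>\<^sub>2 < 0"
  shows "\<not> (\<exists>\<phi>\<in>rational_functions (Lambda m k d).
            \<phi> \<noteq> 0 \<and> A_hypergeometric (Lambda m k d) (\<alpha>\<^sub>1, \<alpha>\<^sub>2) \<phi>)"
proof
  let ?L = "Lambda m k d"
  assume "\<exists>\<phi>\<in>rational_functions ?L. \<phi> \<noteq> 0 \<and> A_hypergeometric ?L (\<alpha>\<^sub>1, \<alpha>\<^sub>2) \<phi>"
  then obtain p q where pq: "vars p \<subseteq> ?L" "vars q \<subseteq> ?L" "q \<noteq> 0" "Fract p q \<noteq> 0"
    "A_hypergeometric ?L (\<alpha>\<^sub>1, \<alpha>\<^sub>2) (Fract p q)"
    unfolding rational_functions_def by blast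
  have k: "0 < k i" "k i < d" if "i \<in> {1..m}" for i
  proof -
    have "k 1 \<le> k i" "k i \<le> k m"
      using that assms(3) by (auto simp: strict_mono_on_leD)
    then show "0 < k i" "k i < d" using assms by auto
  qed
  then have L: "finite ?L" "0 \<in> ?L" "d \<in> ?L" "?L \<subseteq> {0..d}" "k 1 \<in> ?L" "k 1 < d"
    using assms(1) by (auto simp: Lambda_def less_imp_le)
  \<comment> \<open>The base \<open>B\<close> exceeds all exponents in \<open>q\<close>, so that the weight separates its monomials, and
    \<open>d\<close>, which makes the convexity of \<open>j \<mapsto> B ^ j\<close> strong enough for the circuits.\<close>
  define E where "E = (\<Union>r\<in>Poly_Mapping.keys q. range (Poly_Mapping.lookup r))"
  have "finite (range (Poly_Mapping.lookup r))" for r :: "nat \<Rightarrow>\<^sub>0 nat"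
  proof (rule finite_subset)
    show "range (Poly_Mapping.lookup r) \<subseteq> insert 0 (Poly_Mapping.lookup r ` Poly_Mapping.keys r)"
      by (auto simp: in_keys_iff image_iff)
  qed simp
  then have E: "finite E" unfolding E_def by simp
  define B where "B = int (Max (insert d E)) + 1"
  have B: "int d < B" "\<And>r j. r \<in> Poly_Mapping.keys q \<Longrightarrow> int (Poly_Mapping.lookup r j) < B"
  proof -
    have "d \<le> Max (insert d E)" using E by simp
    then show "int d < B" by (simp add: B_def)
    fix r j assume "r \<in> Poly_Mapping.keys q"
    then have "Poly_Mapping.lookup r j \<in> E" unfolding E_def by blast
    then have "Poly_Mapping.lookup r j \<le> Max (insert d E)" using E by (intro Max_ge) auto
    then show "int (Poly_Mapping.lookup r j) < B" by (simp add: B_def)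
  qed
  define W :: "(nat \<Rightarrow> int) \<Rightarrow> int" where "W u = (\<Sum>j\<le>d. u j * B ^ j)" for u
  interpret weight W
    by unfold_locales (simp add: W_def sum.distrib algebra_simps)
  have inj: "r = s" if rs: "r \<in> Poly_Mapping.keys q" "s \<in> Poly_Mapping.keys q"
    and eq: "W (exponent r) = W (exponent s)" for r s
  proof (rule poly_mapping_eqI)
    fix j
    show "Poly_Mapping.lookup r j = Poly_Mapping.lookup s j"
    proof (cases "j \<le> d")
      case True
      have "(\<Sum>j\<le>d. (exponent r j - exponent s j) * B ^ j) = 0"
        using eq by (simp add: W_def left_diff_distrib sum_subtractf)
      moreover have "\<bar>exponent r j - exponent s j\<bar> < B" for j
        using B(2)[OF rs(1), of j] B(2)[OF rs(2), of j] by (auto simp: exponent_def)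
      ultimately have "exponent r j - exponent s j = 0"
        using True by (rule base_representation_zero)
      then show ?thesis by (simp add: exponent_def)
    next
      case False
      then have "j \<notin> Poly_Mapping.keys r" "j \<notin> Poly_Mapping.keys s"
        using rs pq(2) L(4) unfolding vars_def by force+
      then show ?thesis by (simp add: in_keys_iff)
    qed
  qed
  obtain \<mu> where lead: "leading q \<mu>"
  proof -
    let ?A = "(\<lambda>r. W (exponent r)) ` Poly_Mapping.keys q"
    have A: "finite ?A" "?A \<noteq> {}" using pq(3) by auto
    obtain \<mu> where \<mu>: "\<mu> \<in> Poly_Mapping.keys q" "W (exponent \<mu>) = Max ?A"
      using Max_in[OF A] by auto
    have "W (exponent r) < W (exponent \<mu>)" if "r \<in> Poly_Mapping.keys q - {\<mu>}" for r
    proof -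
      have "W (exponent r) \<le> W (exponent \<mu>)" unfolding \<mu>(2) using that A by (intro Max_ge) auto
      then show ?thesis using inj[of r \<mu>] that \<mu>(1) by force
    qed
    then show ?thesis using that[of \<mu>] \<mu> unfolding leading_def by blast
  qed
  obtain c where c: "bounded c" "\<And>u j. c u \<noteq> 0 \<Longrightarrow> j \<notin> ?L \<Longrightarrow> u j = 0"
    "act q c = act p one_series"
    using expansion_exists[OF lead pq(1,2)] by blast
  have exp: "expands (Fract p q) c"
    unfolding expands_def using c leading_cancellable[OF lead] by blast
  interpret hypergeometric_series W ?L \<alpha>\<^sub>1 \<alpha>\<^sub>2 c
    by (rule expansion_is_hypergeometric_series[OF L(1) exp pq(5)]) (rule c(2))
  interpret convex_weight_series W ?L \<alpha>\<^sub>1 \<alpha>\<^sub>2 c d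
  proof
    show "?L \<subseteq> {0..d}" "0 \<in> ?L" "d \<in> ?L" "int d * \<alpha>\<^sub>1 < \<alpha>\<^sub>2" "\<alpha>\<^sub>2 < 0" using L assms by auto
    fix j assume j: "0 < j" "j < d"
    have "W (circuit d j) = (\<Sum>i\<le>d. (if i = 0 then int d - int j else 0) +
        (if i = j then - int d * B ^ j else 0) + (if i = d then int j * B ^ d else 0))"
      unfolding W_def circuit_def using j by (intro sum.cong) auto
    also have "\<dots> = (int d - int j) - int d * B ^ j + int j * B ^ d"
      using j by (simp add: sum.distrib)
    finally have W: "W (circuit d j) = (int d - int j) - int d * B ^ j + int j * B ^ d" .
    have "int d * B ^ j \<le> B * B ^ j" using B by (intro mult_right_mono) auto
    also have "\<dots> = B ^ Suc j" by simp
    also have "\<dots> \<le> B ^ d" using B j by (intro power_increasing) auto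
    also have "\<dots> \<le> int j * B ^ d" using mult_right_mono[of 1 "int j" "B ^ d"] B j by simp
    finally show "0 < W (circuit d j)" unfolding W using j by simp
  qed
  have "c = 0"
    using not_expansion_of_rational_function[OF lead c(3) L(5)] k[of 1] assms(1) by (auto simp: fun_eq_iff)
  then show False using exp expands_eq_0 pq(4) by blast
qed

end
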